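(* Let $p$ be a prime and $n>1$ an integer, and let $s$ denote the smallest prime divisor of $n$. Then for each $t\in\{2,3\}$ there exists a $t$-fold blocking set of size $t\left(p^n+p^{n(s-1)/s}+1\right)$ in $\mathrm{PG}(2,p^n)$.
   Context: $\mathrm{PG}(2,q)$ denotes the Desarguesian projective plane over the finite field $\mathbb{F}_q$. A $t$-fold blocking set of a projective plane is a set of points meeting every line of the plane in at least $t$ points. *)

theory Defs
  imports "HOL-Computational_Algebra.Primes"
begin

text \<open>The Desarguesian projective plane PG(2,F) over a field F, modelled by
homogeneous coordinates: a point is the set of nonzero scalar multiples of a
nonzero vector of F^3; a line is given by a nonzero coordinate vector u and
consists of the points v with u0 v0 + u1 v1 + u2 v2 = 0.\<close>

type_synonym 'a vec3 = "'a \<times> 'a \<times> 'a"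

definition pg_point :: "'a::field vec3 \<Rightarrow> 'a vec3 set" where
  "pg_point v = (case v of (x, y, z) \<Rightarrow> {(c * x, c * y, c * z) | c. c \<noteq> 0})"

definition pg_points :: "'a::field vec3 set set" where
  "pg_points = {pg_point v | v. v \<noteq> (0, 0, 0)}"

definition incident :: "'a::field vec3 \<Rightarrow> 'a vec3 \<Rightarrow> bool" where
  "incident u v = (case u of (a, b, c) \<Rightarrow> case v of (x, y, z) \<Rightarrow> a * x + b * y + c * z = 0)"

definition pg_line :: "'a::field vec3 \<Rightarrow> 'a vec3 set set" where
  "pg_line u = {P \<in> pg_points. \<exists>v \<in> P. incident u v}"

definition pg_lines :: "'a::field vec3 set set set" where
  "pg_lines = {pg_line u | u. u \<noteq> (0, 0, 0)}"

definition t_fold_blocking_set :: "nat \<Rightarrow> 'a::field vec3 set set \<Rightarrow> bool" where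
  "t_fold_blocking_set t B \<longleftrightarrow> B \<subseteq> pg_points \<and> (\<forall>L \<in> pg_lines. card (B \<inter> L) \<ge> t)"

end

theory Submission
  imports Defs "HOL-Computational_Algebra.Polynomial"
begin

text \<open>Let \<open>K\<close> be the subfield of order \<open>k = p ^ (n / s)\<close> of the field \<open>F\<close> with \<open>p ^ n\<close> elements,
  \<open>f : F \<rightarrow> K\<close> a \<open>K\<close>-linear functional and \<open>w\<close> an element of \<open>F\<close> with \<open>f 1 = 1\<close>, \<open>f w = 0\<close> and
  \<open>f (w * w) \<noteq> 0\<close>. The \<open>K\<close>-linear set of the vectors \<open>(x, f x + b * w, b)\<close> with \<open>x \<in> F\<close>, \<open>b \<in> K\<close>
  has \<open>K\<close>-dimension \<open>s + 1\<close> and hence meets every line; it has \<open>k ^ s + k ^ (s - 1) + 1\<close> points.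
  The collineation \<open>(x, y, z) \<mapsto> (y, z, c * x)\<close> has order three on points, so its
  orbit of this blocking set consists of three pairwise disjoint sets as soon as the first two
  are disjoint. That is a condition on \<open>c\<close> only, satisfied for a suitable \<open>c\<close> by counting.\<close>

section \<open>Points and blocking sets\<close>

fun scale3 :: "'a::field \<Rightarrow> 'a vec3 \<Rightarrow> 'a vec3" where
  "scale3 c (x, y, z) = (c * x, c * y, c * z)"

lemma pg_point_alt: "pg_point v = {scale3 c v | c. c \<noteq> 0}"
  by (cases v) (auto simp: pg_point_def)

lemma pg_point_self: "v \<in> pg_point v"
  by (cases v) (force simp: pg_point_def)

lemma pg_point_eq_imp_scale3:
  assumes "pg_point v = pg_point v'"
  obtains c where "c \<noteq> 0" "v' = scale3 c v"
  using assms pg_point_self[of v'] by (auto simp: pg_point_alt)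

lemma pg_point_scale3:
  assumes "c \<noteq> 0"
  shows "pg_point (scale3 c v) = pg_point v"
proof -
  obtain x y z where v: "v = (x, y, z)" by (cases v)
  have "\<exists>d. (e * x, e * y, e * z) = (d * (c * x), d * (c * y), d * (c * z)) \<and> d \<noteq> 0"
    if "e \<noteq> 0" for e
    using assms that by (intro exI[of _ "e / c"]) auto
  moreover have "\<exists>d. (e * (c * x), e * (c * y), e * (c * z)) = (d * x, d * y, d * z) \<and> d \<noteq> 0"
    if "e \<noteq> 0" for e
    using assms that by (intro exI[of _ "e * c"]) auto
  ultimately show ?thesis
    unfolding v pg_point_def by auto
qed

lemma t_fold_blocking_set_Un:
  fixes A B :: "'a::{finite, field} vec3 set set"
  assumes "t_fold_blocking_set a A" "t_fold_blocking_set b B" "A \<inter> B = {}"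
  shows "t_fold_blocking_set (a + b) (A \<union> B)"
  unfolding t_fold_blocking_set_def
proof (intro conjI ballI)
  show "A \<union> B \<subseteq> pg_points"
    using assms by (auto simp: t_fold_blocking_set_def)
  fix L :: "'a vec3 set set" assume "L \<in> pg_lines"
  then have "a \<le> card (A \<inter> L)" "b \<le> card (B \<inter> L)"
    using assms by (auto simp: t_fold_blocking_set_def)
  moreover have "card ((A \<union> B) \<inter> L) = card (A \<inter> L) + card (B \<inter> L)"
    using assms(3) by (subst card_Un_disjoint[symmetric]) (auto simp: Int_Un_distrib2)
  ultimately show "a + b \<le> card ((A \<union> B) \<inter> L)" by simp
qed

lemma blocking_setI:
  fixes V :: "'a::{finite, field} vec3 set"
  assumes nz: "(0, 0, 0) \<notin> V"
    and inc: "\<And>u. u \<noteq> (0, 0, 0) \<Longrightarrow> \<exists>v\<in>V. incident u v"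
  shows "t_fold_blocking_set 1 (pg_point ` V)"
  unfolding t_fold_blocking_set_def
proof (intro conjI ballI)
  show sub: "pg_point ` V \<subseteq> pg_points"
    using nz by (auto simp: pg_points_def)
  fix L :: "'a vec3 set set" assume "L \<in> pg_lines"
  then obtain u where u: "u \<noteq> (0, 0, 0)" "L = pg_line u" by (auto simp: pg_lines_def)
  then obtain v where v: "v \<in> V" "incident u v" using inc by blast
  then have "pg_point v \<in> pg_point ` V \<inter> L"
    using u sub pg_point_self[of v] by (auto simp: pg_line_def)
  then show "1 \<le> card (pg_point ` V \<inter> L)"
    by (metis One_nat_def Suc_leI card_gt_0_iff empty_iff finite)
qed

section \<open>A collineation of order three on points\<close>

fun shift3 :: "'a::field \<Rightarrow> 'a vec3 \<Rightarrow> 'a vec3" where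
  "shift3 c (x, y, z) = (y, z, c * x)"

lemma inj_shift3: "c \<noteq> 0 \<Longrightarrow> inj (shift3 c)"
  by (auto simp: inj_def)

lemma shift3_scale3: "shift3 c (scale3 d v) = scale3 d (shift3 c v)"
  by (cases v) (simp add: mult_ac)

lemma shift3_cubed: "shift3 c (shift3 c (shift3 c v)) = scale3 c v"
  by (cases v) simp

lemma shift3_image_pg_point: "shift3 c ` pg_point v = pg_point (shift3 c (v :: 'a::field vec3))"
proof -
  have "pg_point v = (\<lambda>d. scale3 d v) ` {d. d \<noteq> 0}" for v :: "'a vec3"
    unfolding pg_point_alt by auto
  then show ?thesis by (simp only: image_image shift3_scale3)
qed

lemma shift3_image_cubed:
  assumes "c \<noteq> 0" "P \<in> pg_points"
  shows "shift3 c ` shift3 c ` shift3 c ` P = P"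
proof -
  obtain v where "P = pg_point v" using assms(2) unfolding pg_points_def by blast
  then show ?thesis
    by (simp only: shift3_image_pg_point shift3_cubed pg_point_scale3[OF assms(1)])
qed

text \<open>Incidence is bilinear, so the linear map passes to the line coordinates as its
  transpose; for \<open>c \<noteq> 0\<close> the preimage of a line is therefore a line.\<close>

lemma incident_shift3: "incident (a, b, d) (shift3 c v) \<longleftrightarrow> incident (d * c, a, b) v"
  by (cases v) (simp add: incident_def algebra_simps)

lemma shift3_image_in_pg_points:
  assumes "c \<noteq> 0" "P \<in> pg_points"
  shows "shift3 c ` P \<in> pg_points"
proof -
  obtain x y z where P: "P = pg_point (x, y, z)" "(x, y, z) \<noteq> (0, 0, 0)"
    using assms(2) by (auto simp: pg_points_def)
  then have "shift3 c (x, y, z) \<noteq> (0, 0, 0)" using assms(1) by auto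
  then show ?thesis unfolding P(1) shift3_image_pg_point pg_points_def by blast
qed

lemma t_fold_blocking_set_shift3:
  fixes B :: "'a::{finite, field} vec3 set set"
  assumes "c \<noteq> 0" and B: "t_fold_blocking_set t B"
  shows "t_fold_blocking_set t (image (shift3 c) ` B)"
  unfolding t_fold_blocking_set_def
proof (intro conjI ballI)
  show "image (shift3 c) ` B \<subseteq> pg_points"
    using B shift3_image_in_pg_points[OF assms(1)] by (auto simp: t_fold_blocking_set_def)
  fix L :: "'a vec3 set set" assume "L \<in> pg_lines"
  then obtain a b d where u: "(a, b, d) \<noteq> (0, 0, 0)" "L = pg_line (a, b, d)"
    by (auto simp: pg_lines_def)
  let ?L = "pg_line (d * c, a, b)"
  have "(d * c, a, b) \<noteq> (0, 0, 0)" using u(1) assms(1) by auto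
  then have "?L \<in> pg_lines" unfolding pg_lines_def by blast
  then have "t \<le> card (B \<inter> ?L)" using B by (auto simp: t_fold_blocking_set_def)
  also have "\<dots> = card (image (shift3 c) ` (B \<inter> ?L))"
    using inj_shift3[OF assms(1)]
    by (metis card_image inj_image_eq_iff inj_onI)
  also have "\<dots> \<le> card (image (shift3 c) ` B \<inter> L)"
  proof (rule card_mono)
    show "image (shift3 c) ` (B \<inter> ?L) \<subseteq> image (shift3 c) ` B \<inter> L"
      using u(2) shift3_image_in_pg_points[OF assms(1)]
      by (auto simp: pg_line_def incident_shift3)
  qed simp
  finally show "t \<le> card (image (shift3 c) ` B \<inter> L)" .
qed

text \<open>Applying \<open>g\<close> to the hypothesis separates the second set from the third. As
  the cube of \<open>g\<close> fixes \<open>B\<close>, \<open>g\<close> maps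
  \<open>B \<inter> g (g B)\<close> into \<open>g B \<inter> B\<close>, which is empty.\<close>

lemma shift3_orbit_disjoint:
  fixes B :: "'a::field vec3 set set"
  assumes "c \<noteq> 0" "B \<subseteq> pg_points" and disj: "B \<inter> image (shift3 c) ` B = {}"
  defines "g \<equiv> image (image (shift3 c))"
  shows "(B \<union> g B) \<inter> g (g B) = {}"
proof -
  have inj: "inj (image (shift3 c))"
    using inj_shift3[OF assms(1)] by (simp add: inj_image_eq_iff inj_def)
  have "g B \<inter> g (g B) = g (B \<inter> g B)"
    unfolding g_def by (rule image_Int[OF inj, symmetric])
  then have 1: "g B \<inter> g (g B) = {}" using disj by (simp add: g_def)
  have "g (g (g B)) = (\<lambda>P. shift3 c ` shift3 c ` shift3 c ` P) ` B"
    by (simp add: g_def image_image)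
  also have "\<dots> = (\<lambda>P. P) ` B"
    using assms(1,2) by (intro image_cong refl shift3_image_cubed) auto
  finally have "g (g (g B)) = B" by simp
  moreover have "g (B \<inter> g (g B)) = g B \<inter> g (g (g B))"
    unfolding g_def by (rule image_Int[OF inj])
  ultimately have "g (B \<inter> g (g B)) = {}" using disj by (simp add: g_def Int_commute)
  then have "B \<inter> g (g B) = {}" by (simp add: g_def)
  with 1 show ?thesis by blast
qed

section \<open>Blocking sets from a linear functional\<close>

text \<open>\<open>K\<close> contains \<open>f 1 = 1\<close> and \<open>f w = 0\<close>, so closure
  under differences and quotients makes it a subfield; \<open>f\<close> is a \<open>K\<close>-linear
  projection onto it.\<close>

locale subfield_functional =
  fixes K :: "'a::{finite, field} set" and f :: "'a \<Rightarrow> 'a" and w :: 'a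
  assumes K_diff: "a \<in> K \<Longrightarrow> b \<in> K \<Longrightarrow> a - b \<in> K"
    and K_divide: "a \<in> K \<Longrightarrow> b \<in> K \<Longrightarrow> a / b \<in> K"
    and f_in_K: "f x \<in> K"
    and f_add: "f (x + y) = f x + f y"
    and f_scale: "a \<in> K \<Longrightarrow> f (a * x) = a * f x"
    and f_1: "f 1 = 1"
    and f_w: "f w = 0"
    and f_w2: "f (w * w) \<noteq> 0"
begin

lemma one_in_K: "1 \<in> K"
  using f_in_K[of 1] f_1 by simp

lemma zero_in_K: "0 \<in> K"
  using f_in_K[of w] f_w by simp

lemma f_K: "a \<in> K \<Longrightarrow> f a = a"
  using f_scale[of a 1] f_1 by simp

text \<open>\<open>f\<close> is the identity on \<open>K\<close>, so \<open>w\<close> in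
  \<open>K\<close> would force \<open>w = f w = 0\<close>, against \<open>f_w2\<close>. This makes
  the denominators \<open>w + e\<close> below nonzero.\<close>

lemma w_plus_K_nonzero: "a \<in> K \<Longrightarrow> w + a \<noteq> 0"
proof
  assume a: "a \<in> K" "w + a = 0"
  then have "f w + f a = f 0" by (metis f_add)
  then have "a = 0" using a f_w f_K zero_in_K by simp
  then have "w = 0" using a by simp
  then show False using f_w2 f_K[OF zero_in_K] by simp
qed

text \<open>One representative for each point of the linear set, with last nonzero coordinate 1:
  scalars from \<open>K\<close> normalise \<open>b\<close> if it is nonzero, otherwise
  \<open>f x\<close> if that is nonzero, and the remaining vectors \<open>(x, 0, 0)\<close> all give
  the point of \<open>(1, 0, 0)\<close>.\<close>

definition vectors :: "'a vec3 set" where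
  "vectors = range (\<lambda>x. (x, f x + w, 1)) \<union> (\<lambda>x. (x, 1, 0)) ` {x. f x = 1} \<union> {(1, 0, 0)}"

definition point_set :: "'a vec3 set set" where
  "point_set = pg_point ` vectors"

lemma vectors_cases:
  assumes "v \<in> vectors"
  obtains (affine) x where "v = (x, f x + w, 1)" | (infinite) x where "v = (x, 1, 0)" "f x = 1"
    | (centre) "v = (1, 0, 0)"
  using assms by (auto simp: vectors_def)

lemma inj_on_pg_point_vectors: "inj_on pg_point vectors"
proof (rule inj_onI)
  fix v v' assume v: "v \<in> vectors" "v' \<in> vectors" and "pg_point v = pg_point v'"
  then obtain c where "c \<noteq> 0" "v' = scale3 c v" by (elim pg_point_eq_imp_scale3)
  then show "v = v'" using v by (elim vectors_cases) auto
qed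

lemma card_point_set:
  "card point_set = card (UNIV :: 'a set) + card {x. f x = 1} + 1"
proof -
  have "card point_set = card vectors"
    unfolding point_set_def by (rule card_image[OF inj_on_pg_point_vectors])
  also have "\<dots> = card (range (\<lambda>x. (x, f x + w, 1::'a)) \<union> (\<lambda>x. (x, 1::'a, 0::'a)) ` {x. f x = 1}) + 1"
    unfolding vectors_def by (subst card_Un_disjoint) auto
  also have "card (range (\<lambda>x. (x, f x + w, 1::'a)) \<union> (\<lambda>x. (x, 1::'a, 0::'a)) ` {x. f x = 1})
     = card (range (\<lambda>x. (x, f x + w, 1::'a))) + card ((\<lambda>x. (x, 1::'a, 0::'a)) ` {x. f x = 1})"
    by (subst card_Un_disjoint) auto
  also have "card (range (\<lambda>x. (x, f x + w, 1::'a))) = card (UNIV :: 'a set)"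
    by (rule card_image) (auto simp: inj_def)
  also have "card ((\<lambda>x. (x, 1::'a, 0::'a)) ` {x. f x = 1}) = card {x. f x = 1}"
    by (rule card_image) (auto simp: inj_on_def)
  finally show ?thesis .
qed

lemma blocking_point_set: "t_fold_blocking_set 1 point_set"
  unfolding point_set_def
proof (rule blocking_setI)
  show "(0, 0, 0) \<notin> vectors" by (auto simp: vectors_def)
  fix u :: "'a vec3" assume "u \<noteq> (0, 0, 0)"
  obtain a b d where u: "u = (a, b, d)" by (cases u)
  show "\<exists>v\<in>vectors. incident u v"
  proof (cases "a = 0")
    case True
    then show ?thesis by (intro bexI[of _ "(1, 0, 0)"]) (auto simp: u incident_def vectors_def)
  next
    case a: False
    \<comment> \<open>The line now has the equation
      \<open>x = \<beta> * y + \<gamma> * z\<close>.\<close>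
    define \<beta> where "\<beta> = - b / a"
    define \<gamma> where "\<gamma> = - d / a"
    have b: "b = - a * \<beta>" and d: "d = - a * \<gamma>" using a by (auto simp: \<beta>_def \<gamma>_def)
    show ?thesis
    proof (cases "f \<beta> = 1")
      case True
      then show ?thesis
        by (intro bexI[of _ "(\<beta>, 1, 0)"]) (auto simp: u b incident_def vectors_def)
    next
      case False
      \<comment> \<open>On an affine vector with \<open>e = f x\<close> the equation reads
        \<open>x = e * \<beta> + (\<beta> * w + \<gamma>)\<close>. Applying \<open>f\<close> gives a
        linear equation for \<open>e\<close>, solvable because
        \<open>f \<beta> \<noteq> 1\<close>.\<close>
      define e where "e = f (\<beta> * w + \<gamma>) / (1 - f \<beta>)"
      define x where "x = e * \<beta> + (\<beta> * w + \<gamma>)"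
      have "e \<in> K" unfolding e_def by (intro K_divide K_diff f_in_K one_in_K)
      then have "f x = e * f \<beta> + f (\<beta> * w + \<gamma>)" by (simp add: x_def f_add[of "e * \<beta>"] f_scale)
      also have "f (\<beta> * w + \<gamma>) = e * (1 - f \<beta>)" using False by (simp add: e_def)
      finally have "f x = e" by (simp add: algebra_simps)
      then have "incident u (x, f x + w, 1)"
        by (simp add: u b d incident_def x_def algebra_simps)
      then show ?thesis by (auto simp: vectors_def)
    qed
  qed
qed

section \<open>Making the translates disjoint\<close>

text \<open>Among the scalars \<open>v \<in> K\<close>, each \<open>e \<in> K - {0, f (w * w)}\<close> rules out at most one,
  \<open>e = f (w * w)\<close> rules out only \<open>v = 0\<close>, and \<open>e = 0\<close> rules out none.\<close>
lemma ex_shift_multiplier: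
  obtains c where "c \<noteq> 0" "\<And>e. e \<in> K \<Longrightarrow> f (w * w) + e * f (1 / (c * (w + e))) \<noteq> e"
proof -
  define m where "m = f (w * w)"
  have m: "m \<in> K" "m \<noteq> 0" using f_w2 f_in_K by (auto simp: m_def)
  define bad where "bad = insert 0 ((\<lambda>e. (1 - m / e) / f ((w + m) / (w + e))) ` (K - {0, m}))"
  have "card bad \<le> Suc (card ((\<lambda>e. (1 - m / e) / f ((w + m) / (w + e))) ` (K - {0, m})))"
    by (simp add: bad_def card_insert_if)
  also have "\<dots> \<le> Suc (card (K - {0, m}))"
    by (simp add: card_image_le)
  also have "card (K - {0, m}) = card K - 2"
    using m zero_in_K by (subst card_Diff_subset) auto
  also have "2 \<le> card K"
    using card_mono[of K "{0, m}"] m zero_in_K by auto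
  then have "Suc (card K - 2) < card K" by simp
  finally have "\<not> K \<subseteq> bad" using card_mono[of bad K] by force
  then obtain v where v: "v \<in> K" "v \<notin> bad" by blast
  \<comment> \<open>This makes \<open>f (1 / (c * (w + e)))\<close> equal to \<open>v\<close> times
    a factor independent of \<open>v\<close>; by the choice of \<open>w + m\<close> that factor is 1
    for \<open>e = m\<close>.\<close>
  define c where "c = 1 / (v * (w + m))"
  have v0: "v \<noteq> 0" using v by (auto simp: bad_def)
  have "c \<noteq> 0" using v0 w_plus_K_nonzero[OF m(1)] by (simp add: c_def)
  moreover have "m + e * f (1 / (c * (w + e))) \<noteq> e" if e: "e \<in> K" for e
  proof
    assume *: "m + e * f (1 / (c * (w + e))) = e"
    have "1 / (c * (w + e)) = v * ((w + m) / (w + e))" by (simp add: c_def)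
    then have eq: "m + e * (v * f ((w + m) / (w + e))) = e" using * f_scale[OF v(1)] by metis
    have e0: "e \<noteq> 0" using eq m by auto
    have em: "e \<noteq> m"
    proof
      assume "e = m"
      then have "m * (v * 1) = 0" using eq w_plus_K_nonzero[OF m(1)] f_1 by simp
      then show False using m v0 by simp
    qed
    have "v * f ((w + m) / (w + e)) = 1 - m / e"
      using eq e0 by (simp add: field_simps)
    moreover from this have "f ((w + m) / (w + e)) \<noteq> 0" using em e0 by auto
    ultimately have "v = (1 - m / e) / f ((w + m) / (w + e))" by (simp add: field_simps)
    then show False using v(2) e e0 em by (auto simp: bad_def)
  qed
  ultimately show ?thesis using that by (simp add: m_def)
qed

text \<open>Pairs involving a non-affine vector clash in a zero coordinate or with
  \<open>f w = 0\<close> or \<open>f 0 = 0\<close>. For two affine vectors the scalar must be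
  \<open>w + e\<close>, and applying \<open>f\<close> to the first coordinate gives exactly the
  equation excluded by the choice of \<open>c\<close>.\<close>

lemma point_set_shift3_disjoint:
  assumes c: "c \<noteq> 0" "\<And>e. e \<in> K \<Longrightarrow> f (w * w) + e * f (1 / (c * (w + e))) \<noteq> e"
  shows "point_set \<inter> image (shift3 c) ` point_set = {}"
proof -
  have False if v: "v \<in> vectors" "v' \<in> vectors" and eq: "pg_point v = pg_point (shift3 c v')" for v v'
  proof -
    obtain d where d: "d \<noteq> 0" "v = scale3 d (shift3 c v')"
      using pg_point_eq_imp_scale3[OF eq[symmetric]] .
    have nz: "f x + w \<noteq> 0" for x
      using w_plus_K_nonzero[OF f_in_K[of x]] by (simp add: add.commute)
    from v(1) show False
    proof (cases rule: vectors_cases)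
      case v1: (affine x)
      from v(2) show False
      proof (cases rule: vectors_cases)
        case (affine x')
        define e e' where "e = f x" and "e' = f x'"
        have "x = d * (e' + w) \<and> e + w = d \<and> 1 = d * (c * x')"
          unfolding e_def e'_def using d(2)
          unfolding v1 affine scale3.simps shift3.simps prod.inject mult_1_right by blast
        then have x: "x = (w + e) * (w + e')" and x': "(w + e) * (c * x') = 1"
          by (simp_all add: add.commute)
        have eK: "e \<in> K" "e' \<in> K" by (simp_all add: e_def e'_def f_in_K)
        \<comment> \<open>The factor 1 lets \<open>f_scale\<close> extract both \<open>e\<close> and
          \<open>e'\<close>, leaving \<open>f 1\<close>.\<close>
        have "e = f (w * w + (e * w + (e' * w + e * (e' * 1))))"
          using e_def by (simp add: x algebra_simps)
        also have "\<dots> = f (w * w) + e * e'"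
          by (simp add: f_add f_scale eK f_w f_1 del: mult_1_right)
        finally have "e = f (w * w) + e * e'" .
        moreover have "x' = 1 / (c * (w + e))"
          using x' w_plus_K_nonzero[OF eK(1)] c(1) by (simp add: eq_divide_eq mult_ac)
        ultimately show False using c(2)[OF eK(1)] by (simp add: e'_def)
      qed (use d nz[of x] in \<open>auto simp: v1\<close>)
    next
      case v1: (infinite x)
      from v(2) show False
      proof (cases rule: vectors_cases)
        case (affine x')
        then show False using d c(1) v1 f_w f_K[OF zero_in_K] by auto
      qed (use d in \<open>auto simp: v1\<close>)
    next
      case v1: centre
      from v(2) show False
      proof (cases rule: vectors_cases)
        case (infinite x')
        then show False using d c(1) v1 f_K[OF zero_in_K] by auto
      qed (use d in \<open>auto simp: v1\<close>)
    qed
  qed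
  then show ?thesis
    unfolding point_set_def image_image shift3_image_pg_point by blast
qed

lemma ex_t_fold_blocking_set:
  assumes "t \<in> {2, 3}"
  shows "\<exists>B :: 'a vec3 set set. t_fold_blocking_set t B \<and>
           card B = t * (card (UNIV :: 'a set) + card {x. f x = 1} + 1)"
proof -
  obtain c where c: "c \<noteq> 0" "\<And>e. e \<in> K \<Longrightarrow> f (w * w) + e * f (1 / (c * (w + e))) \<noteq> e"
    by (rule ex_shift_multiplier) blast
  define g where "g = image (image (shift3 c))"
  let ?B = point_set
  have bl: "t_fold_blocking_set 1 ?B" "t_fold_blocking_set 1 (g ?B)"
    "t_fold_blocking_set 1 (g (g ?B))"
    unfolding g_def by (intro t_fold_blocking_set_shift3 blocking_point_set c(1))+
  have disj: "?B \<inter> g ?B = {}" unfolding g_def by (rule point_set_shift3_disjoint[OF c])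
  have disj': "(?B \<union> g ?B) \<inter> g (g ?B) = {}"
    using shift3_orbit_disjoint[OF c(1) _ disj[unfolded g_def]] bl(1)
    by (simp add: g_def t_fold_blocking_set_def)
  have "inj (image (shift3 c))"
    using inj_shift3[OF c(1)] by (simp add: inj_image_eq_iff inj_def)
  then have card_g: "card (g A) = card A" for A
    unfolding g_def by (rule card_image[OF inj_on_subset]) simp
  have bl2: "t_fold_blocking_set 2 (?B \<union> g ?B)"
    using t_fold_blocking_set_Un[OF bl(1,2) disj] by (simp add: numeral_2_eq_2)
  have bl3: "t_fold_blocking_set 3 (?B \<union> g ?B \<union> g (g ?B))"
    using t_fold_blocking_set_Un[OF bl2 bl(3) disj'] by simp
  have card2: "card (?B \<union> g ?B) = 2 * card ?B"
    using disj by (simp add: card_Un_disjoint card_g)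
  have card3: "card (?B \<union> g ?B \<union> g (g ?B)) = 3 * card ?B"
    using disj' by (simp add: card_Un_disjoint card_g card2)
  show ?thesis
    using assms bl2 bl3 card2 card3 unfolding card_point_set[symmetric] by blast
qed

end

section \<open>The trace to a subfield\<close>

text \<open>Multiplication by a nonzero \<open>x\<close> permutes the nonzero elements, so their
  product can be cancelled.\<close>

lemma power_card_UNIV_eq_same:
  fixes x :: "'a::{finite, field}"
  shows "x ^ card (UNIV :: 'a set) = x"
proof (cases "x = 0")
  case False
  let ?S = "UNIV - {0::'a}"
  have "bij_betw ((*) x) ?S ?S"
    by (rule bij_betw_byWitness[of _ "\<lambda>y. y / x"]) (use False in auto)
  from prod.reindex_bij_betw[OF this, of "\<lambda>y. y"] have "x ^ card ?S * \<Prod>?S = \<Prod>?S"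
    by (simp add: prod.distrib)
  then have "x ^ card ?S = 1" by simp
  moreover have "card (UNIV :: 'a set) = Suc (card ?S)"
    by (rule card.remove) auto
  ultimately show ?thesis by (metis power_Suc mult_1_right)
qed (simp add: card_gt_0_iff power_0_left)

text \<open>Translation by 1 permutes the field; summing all elements shows that the field order is
  0 in the field, so the characteristic divides \<open>p ^ n\<close>.\<close>

lemma card_power_prime_imp_CHAR:
  assumes "prime p" "card (UNIV :: 'a::{finite, field} set) = p ^ n"
  shows "CHAR('a) = p"
proof -
  have "prime CHAR('a)"
    by (intro prime_CHAR_semidom finite_imp_CHAR_pos) simp
  moreover have "CHAR('a) dvd p ^ n"
  proof -
    have "bij (\<lambda>y::'a. y + 1)" by (rule bij_betw_byWitness[of _ "\<lambda>y. y - 1"]) auto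
    from sum.reindex_bij_betw[OF this, of "\<lambda>y. y"] have "of_nat (card (UNIV :: 'a set)) = (0::'a)"
      by (simp add: sum.distrib)
    then show ?thesis using assms(2) by (simp only: of_nat_eq_0_iff_char_dvd)
  qed
  ultimately show ?thesis
    using assms(1) by (metis prime_dvd_power primes_dvd_imp_eq)
qed

text \<open>In a field with \<open>k ^ s\<close> elements this is the trace to the subfield of order
  \<open>k\<close>.\<close>

definition rel_trace :: "nat \<Rightarrow> nat \<Rightarrow> 'a::field \<Rightarrow> 'a" where
  "rel_trace k s x = (\<Sum>i<s. x ^ (k ^ i))"

lemma card_rel_trace_fibre_le:
  fixes c :: "'a::{finite, field}"
  assumes "k > 1" "s > 0"
  shows "card {x. rel_trace k s x = c} \<le> k ^ (s - 1)"
proof -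
  define P :: "'a poly" where "P = (\<Sum>i<s. monom 1 (k ^ i)) - [:c:]"
  have deg: "degree P \<le> k ^ (s - 1)"
    unfolding P_def
  proof (intro degree_diff_le degree_sum_le)
    fix i assume "i \<in> {..<s}"
    then have "k ^ i \<le> k ^ (s - 1)" using assms by (intro power_increasing) auto
    then show "degree (monom (1::'a) (k ^ i)) \<le> k ^ (s - 1)"
      using degree_monom_le order_trans by blast
  qed auto
  \<comment> \<open>The exponents are distinct as \<open>k > 1\<close>, so only
    \<open>i = s - 1\<close> contributes; \<open>k ^ (s - 1)\<close> is positive, so the constant
    \<open>c\<close> does not.\<close>
  have "coeff P (k ^ (s - 1)) = (\<Sum>i<s. if i = s - 1 then 1 else 0) - coeff [:c:] (k ^ (s - 1))"
    unfolding P_def coeff_diff coeff_sum using assms(1)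
    by (intro arg_cong2[where f = "(-)"] sum.cong) (auto simp: power_inject_exp)
  also have "coeff [:c:] (k ^ (s - 1)) = 0" using assms by (simp add: coeff_pCons split: nat.split)
  also have "(\<Sum>i<s. if i = s - 1 then 1 else 0) = (1::'a)" using assms(2) by simp
  finally have "P \<noteq> 0" by auto
  from card_poly_roots_bound[OF this] deg show ?thesis
    by (simp add: P_def poly_sum poly_monom rel_trace_def)
qed

lemma card_fixed_by_power_le:
  assumes "k > 1"
  shows "card {x::'a::{finite, field}. x ^ k = x} \<le> k"
proof -
  define P :: "'a poly" where "P = monom 1 k - [:0, 1:]"
  have "coeff P k = 1" using assms by (auto simp: P_def coeff_pCons split: nat.split)
  then have "P \<noteq> 0" by auto
  moreover have "degree P \<le> k"
    unfolding P_def using assms by (intro degree_diff_le) (auto simp: degree_monom_le)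
  ultimately have "card {x. poly P x = 0} \<le> k" using card_poly_roots_bound order_trans by blast
  then show ?thesis by (simp add: P_def poly_monom)
qed

section \<open>The trace onto the fixed field of the \<open>k\<close>-th power map\<close>

context
  fixes p n r s k :: nat and K :: "'a::{finite, field} set"
  assumes p: "prime p" and card_UNIV: "card (UNIV :: 'a set) = p ^ n"
    and n: "n = r * s" and r: "r > 0" and s: "s > 1"
  defines "k \<equiv> p ^ r" and "K \<equiv> {x. x ^ k = x}"
begin

lemma k_gt_1: "k > 1"
  unfolding k_def using prime_gt_1_nat[OF p] r by (rule one_less_power)

lemma card_UNIV_k: "card (UNIV :: 'a set) = k ^ s"
  by (simp add: card_UNIV n k_def power_mult)

lemma prime_CHAR: "prime CHAR('a)"
  using card_power_prime_imp_CHAR[OF p card_UNIV] p by simp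

lemma k_power_CHAR: "k ^ i = CHAR('a) ^ (r * i)"
  using card_power_prime_imp_CHAR[OF p card_UNIV] by (simp add: k_def power_mult)

lemma frobenius_add: "(x + y :: 'a) ^ (k ^ i) = x ^ (k ^ i) + y ^ (k ^ i)"
  by (rule freshmans_dream'[OF prime_CHAR k_power_CHAR])

lemma frobenius_diff: "(x - y :: 'a) ^ k = x ^ k - y ^ k"
  using frobenius_add[of "x - y" y 1] by simp

lemma trace_add: "rel_trace k s (x + y :: 'a) = rel_trace k s x + rel_trace k s y"
  by (simp add: rel_trace_def frobenius_add sum.distrib)

lemma fixed_by_power: "a \<in> K \<Longrightarrow> a ^ (k ^ i) = a"
  by (induction i) (auto simp: K_def power_mult)

lemma trace_scale: "a \<in> K \<Longrightarrow> rel_trace k s (a * x) = a * rel_trace k s x"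
  by (simp add: rel_trace_def power_mult_distrib fixed_by_power sum_distrib_left)

text \<open>Raising to the power \<open>k\<close> permutes the summands cyclically, because
  \<open>x ^ (k ^ s) = x\<close>.\<close>

lemma trace_in_K: "rel_trace k s (x :: 'a) \<in> K"
proof -
  obtain s' where s': "s = Suc s'" using s by (cases s) auto
  have "rel_trace k s x ^ k = (\<Sum>i<s. (x ^ (k ^ i)) ^ k)"
    unfolding rel_trace_def using freshmans_dream_sum'[OF prime_CHAR k_power_CHAR[of 1]] by simp
  also have "\<dots> = (\<Sum>i<s. x ^ (k ^ Suc i))"
    by (simp only: power_mult[symmetric] power_Suc2)
  also have "\<dots> = (\<Sum>i<s'. x ^ (k ^ Suc i)) + x ^ (k ^ s)"
    by (simp add: s')
  also have "x ^ (k ^ s) = x ^ (k ^ 0)"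
    using power_card_UNIV_eq_same[of x] by (simp add: card_UNIV_k)
  also have "(\<Sum>i<s'. x ^ (k ^ Suc i)) + x ^ (k ^ 0) = rel_trace k s x"
    unfolding rel_trace_def s' sum.lessThan_Suc_shift by (simp add: add.commute)
  finally show ?thesis by (simp add: K_def)
qed

lemma K_diff: "a \<in> K \<Longrightarrow> b \<in> K \<Longrightarrow> a - b \<in> K"
  by (simp add: K_def frobenius_diff)

lemma K_divide: "a \<in> K \<Longrightarrow> b \<in> K \<Longrightarrow> a / b \<in> K"
  by (simp add: K_def power_divide)

text \<open>The fibres over the at most \<open>k\<close> elements of \<open>K\<close> have at most \<open>k ^ (s - 1)\<close> elements each,
  and together they have \<open>k ^ s\<close>, so both bounds are attained.\<close>
lemma card_trace_fibre:
  assumes "c \<in> K"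
  shows "card {x::'a. rel_trace k s x = c} = k ^ (s - 1)"
proof (rule ccontr)
  assume "card {x. rel_trace k s x = c} \<noteq> k ^ (s - 1)"
  then have less: "card {x. rel_trace k s x = c} < k ^ (s - 1)"
    using card_rel_trace_fibre_le[OF k_gt_1, of s c] s by simp
  have "k ^ s = card (\<Union>a\<in>K. {x. rel_trace k s x = a})"
    unfolding card_UNIV_k[symmetric] using trace_in_K by (intro arg_cong[where f = card]) auto
  also have "\<dots> = (\<Sum>a\<in>K. card {x. rel_trace k s x = a})"
    by (rule card_UN_disjoint) auto
  also have "\<dots> < (\<Sum>a\<in>K. k ^ (s - 1))"
    using less assms card_rel_trace_fibre_le[OF k_gt_1, of s] s
    by (intro sum_strict_mono_ex1) auto
  also have "\<dots> \<le> k * k ^ (s - 1)"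
    using card_fixed_by_power_le[OF k_gt_1, where ?'a = 'a] by (simp add: K_def)
  also have "\<dots> = k ^ s" using s by (cases s) auto
  finally show False by simp
qed

text \<open>Nondegeneracy of the trace form: the fibre over 1 is nonempty, and division by
  \<open>z\<close> moves an element of it to a suitable \<open>y\<close>.\<close>

lemma ex_trace_nonzero:
  assumes "z \<noteq> (0::'a)"
  obtains y where "rel_trace k s (y * z) \<noteq> 0"
proof -
  have "k ^ (s - 1) > 0" "1 \<in> K" using k_gt_1 by (simp_all add: K_def)
  then have "{x::'a. rel_trace k s x = 1} \<noteq> {}"
    using card_trace_fibre by (metis card.empty less_irrefl)
  then obtain x :: 'a where "rel_trace k s x = 1" by blast
  then show ?thesis using that[of "x / z"] assms by simp
qed

text \<open>Otherwise the functional given by \<open>z\<close> vanishes on the kernel of the one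
  given by \<open>w\<close>, hence is \<open>a\<close> times it for some \<open>a\<close> in
  \<open>K\<close>; nondegeneracy then forces \<open>z = a * w\<close>.\<close>

lemma ex_trace_separating:
  assumes "w \<noteq> (0::'a)" "\<And>a. a \<in> K \<Longrightarrow> z \<noteq> a * w"
  obtains y where "rel_trace k s (y * w) = 0" "rel_trace k s (y * z) \<noteq> 0"
proof (rule ccontr)
  assume "\<not> thesis"
  with that have ker: "rel_trace k s (y * z) = 0" if "rel_trace k s (y * w) = 0" for y
    using that by blast
  obtain y0 where y0: "rel_trace k s (y0 * w) \<noteq> 0" using ex_trace_nonzero[OF assms(1)] .
  define a where "a = rel_trace k s (y0 * z) / rel_trace k s (y0 * w)"
  have "a \<in> K" unfolding a_def by (intro K_divide trace_in_K)
  then have "z - a * w \<noteq> 0" using assms(2) by auto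
  then obtain y where y: "rel_trace k s (y * (z - a * w)) \<noteq> 0" using ex_trace_nonzero by blast
  \<comment> \<open>Subtracting \<open>b * y0\<close> from \<open>y\<close> lands in the kernel of
    the functional given by \<open>w\<close>.\<close>
  define b where "b = rel_trace k s (y * w) / rel_trace k s (y0 * w)"
  have "b \<in> K" unfolding b_def by (intro K_divide trace_in_K)
  have trace_diff: "rel_trace k s (u - v) = rel_trace k s u - rel_trace k s v" for u v :: 'a
    using trace_add[of "u - v" v] by (simp add: algebra_simps)
  have "rel_trace k s ((y - b * y0) * w) = rel_trace k s (y * w) - b * rel_trace k s (y0 * w)"
    using trace_diff[of "y * w" "b * (y0 * w)"] trace_scale[OF \<open>b \<in> K\<close>]
    by (simp add: algebra_simps)
  then have "rel_trace k s ((y - b * y0) * z) = 0" using y0 by (intro ker) (simp add: b_def)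
  then have "rel_trace k s (y * z) = b * rel_trace k s (y0 * z)"
    using trace_diff[of "y * z" "b * (y0 * z)"] trace_scale[OF \<open>b \<in> K\<close>]
    by (simp add: algebra_simps)
  moreover have "rel_trace k s (y * (z - a * w)) = rel_trace k s (y * z) - a * rel_trace k s (y * w)"
    using trace_diff[of "y * z" "a * (y * w)"] trace_scale[OF \<open>a \<in> K\<close>]
    by (simp add: algebra_simps)
  ultimately show False using y y0 by (simp add: a_def b_def)
qed

text \<open>For \<open>w \<notin> K\<close>, neither \<open>1\<close> nor \<open>w * w\<close> lies in \<open>K * w\<close>, so some \<open>y1\<close>, \<open>y2\<close> satisfy
  \<open>Tr (y1 * w) = Tr (y2 * w) = 0\<close>, \<open>Tr y1 \<noteq> 0\<close> and \<open>Tr (y2 * w * w) \<noteq> 0\<close>;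
  one of \<open>y1\<close>, \<open>y2\<close>, \<open>y1 + y2\<close> then has both traces nonzero.\<close>
lemma ex_subfield_functional:
  "\<exists>f w. subfield_functional K f w \<and> card {x. f x = 1} = k ^ (s - 1)"
proof -
  have "card K < card (UNIV :: 'a set)"
  proof -
    have "card K \<le> k" using card_fixed_by_power_le[OF k_gt_1] by (simp add: K_def)
    also have "k < k ^ s" using power_strict_increasing[OF s k_gt_1] by simp
    finally show ?thesis by (simp add: card_UNIV_k)
  qed
  then obtain w where w: "w \<notin> K" by (metis UNIV_I less_irrefl subsetI subset_antisym)
  have "0 \<in> K" "1 \<in> K" using k_gt_1 by (simp_all add: K_def)
  then have w0: "w \<noteq> 0" using w by auto
  have "1 \<noteq> a * w" if "a \<in> K" for a
  proof
    assume a: "1 = a * w"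
    then have "a \<noteq> 0" by auto
    with a have "w = 1 / a" by (simp add: field_simps)
    then show False using K_divide[OF \<open>1 \<in> K\<close> that] w by simp
  qed
  then obtain y1 where y1: "rel_trace k s (y1 * w) = 0" "rel_trace k s y1 \<noteq> 0"
    using ex_trace_separating[OF w0, of 1] by auto
  have "w * w \<noteq> a * w" if "a \<in> K" for a using w0 w that by auto
  then obtain y2 where y2: "rel_trace k s (y2 * w) = 0" "rel_trace k s (y2 * (w * w)) \<noteq> 0"
    using ex_trace_separating[OF w0] by metis
  obtain y where y: "rel_trace k s (y * w) = 0" "rel_trace k s y \<noteq> 0" "rel_trace k s (y * (w * w)) \<noteq> 0"
  proof (cases "rel_trace k s (y1 * (w * w)) = 0 \<and> rel_trace k s y2 = 0")
    case True
    then show ?thesis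
      using that[of "y1 + y2"] y1 y2 by (simp add: trace_add distrib_right)
  next
    case False
    then show ?thesis using that[of y1] that[of y2] y1 y2 by auto
  qed
  define c where "c = rel_trace k s y"
  have c: "c \<in> K" "c \<noteq> 0" using y trace_in_K by (simp_all add: c_def)
  \<comment> \<open>Division by \<open>c\<close> normalises \<open>f 1\<close> to 1; as
    \<open>c\<close> lies in \<open>K\<close>, the values stay in \<open>K\<close>.\<close>
  define f where "f x = rel_trace k s (y * x) / c" for x
  have "subfield_functional K f w"
  proof
    show "f (a * x) = a * f x" if "a \<in> K" for a x
      using trace_scale[OF that, of "y * x"] by (simp add: f_def mult_ac)
  qed (use y c in \<open>auto simp: f_def K_diff K_divide trace_in_K trace_add distrib_left
          add_divide_distrib c_def\<close>)
  moreover have "card {x. f x = 1} = card {x. rel_trace k s x = c}"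
  proof (rule bij_betw_same_card)
    have "y \<noteq> 0" using y(2) trace_scale[OF \<open>0 \<in> K\<close>, of 0] by auto
    then show "bij_betw ((*) y) {x. f x = 1} {x. rel_trace k s x = c}"
      using c(2) by (intro bij_betw_byWitness[of _ "\<lambda>x. x / y"]) (auto simp: f_def)
  qed
  ultimately show ?thesis using card_trace_fibre[OF c(1)] by auto
qed

end

theorem theorem1p2:
  fixes p n s t :: nat
  assumes "prime p" and "n > 1"
    and "prime s" and "s dvd n" and "\<forall>d. prime d \<and> d dvd n \<longrightarrow> s \<le> d"
    and "card (UNIV :: 'a::{finite, field} set) = p ^ n"
    and "t \<in> {2, 3}"
  shows "\<exists>B :: 'a vec3 set set. t_fold_blocking_set t B \<and>
           card B = t * (p ^ n + p ^ (n * (s - 1) div s) + 1)"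
proof -
  obtain r where n: "n = r * s" using assms(4) by (metis dvd_def mult.commute)
  have r: "r > 0" using assms(2) n by (cases r) auto
  have s: "s > 1" by (rule prime_gt_1_nat[OF assms(3)])
  obtain K :: "'a set" and f w where f: "subfield_functional K f w"
    and card: "card {x. f x = 1} = (p ^ r) ^ (s - 1)"
    using ex_subfield_functional[OF assms(1,6) n r s] by blast
  have "n * (s - 1) div s = r * (s - 1)" using s by (simp add: n mult_ac)
  then have "card {x. f x = 1} = p ^ (n * (s - 1) div s)" by (simp add: card power_mult)
  then show ?thesis
    using subfield_functional.ex_t_fold_blocking_set[OF f assms(7)] assms(6) by simp
qed

end
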